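(* Let $\{\widetilde{X}_E:E\in\mathcal{B}_0\}$ be a centered free Poisson random measure (with $\alpha=1$) in a $W^*$-probability space $(\mathcal{A},\varphi)$, and let $s=\sum_{i=1}^nc_i\chi_{E_i}$ be a simple function on $\mathbb{R}$ with $E_1,\dots,E_n$ mutually disjoint Borel sets, $|E_i|<\infty$. Define $\widetilde{X}(s)=\int_{\mathbb{R}}s(x)\widetilde{X}(dx):=\sum_{i=1}^nc_i\widetilde{X}_{E_i}$. Then $\|\widetilde{X}(s)\|_2^2=\|s\|_2^2$.
   Context: A $W^*$-probability space $(\mathcal{A},\varphi)$ is a finite von Neumann algebra with a faithful normal tracial state; $\|a\|_2=\varphi(a^*a)^{1/2}$ for $a\in\mathcal{A}$, and $\|s\|_2$ is the norm of $L^2(\mathbb{R})$. $\kappa_n(a):=\kappa_n(a,\dots,a)$ denotes the usual $n$-th free cumulant. Free Poisson random measure (with $\alpha=1$): a map $E\mapsto X_E$ from the set $\mathcal{B}_0$ of Borel subsets of $\mathbb{R}$ of finite Lebesgue measure $|E|$ into the self-adjoint elements of $\mathcal{A}$ such that (1) $\kappa_n(X_E)=|E|$ for all $n\ge1$; (2) if $E_1,\dots,E_k$ are mutually disjoint, then $X_{E_1},\dots,X_{E_k}$ are freely independent; (3) if $E_1,\dots,E_k$ are mutually disjoint, then $X_{\cup_{i=1}^kE_i}=\sum_{i=1}^kX_{E_i}$. The associated centered free Poisson random measure is $\widetilde{X}_E=X_E-|E|\cdot 1$, $E\in\mathcal{B}_0$. *)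

theory Defs
  imports "HOL-Analysis.Analysis"
begin

section \<open>Complex Hilbert spaces and their bounded operators\<close>

class complex_vector = ab_group_add +
  fixes scaleC :: "complex \<Rightarrow> 'a \<Rightarrow> 'a"  (infixr \<open>*\<^sub>C\<close> 75)
  assumes scaleC_add_right: "c *\<^sub>C (x + y) = c *\<^sub>C x + c *\<^sub>C y"
    and scaleC_add_left: "(c + d) *\<^sub>C x = c *\<^sub>C x + d *\<^sub>C x"
    and scaleC_scaleC: "c *\<^sub>C (d *\<^sub>C x) = (c * d) *\<^sub>C x"
    and scaleC_one: "1 *\<^sub>C x = x"

class complex_algebra = complex_vector + ring + monoid_mult +
  assumes mult_scaleC_left: "(c *\<^sub>C x) * y = c *\<^sub>C (x * y)"
    and mult_scaleC_right: "x * (c *\<^sub>C y) = c *\<^sub>C (x * y)"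

text \<open>The norm and the topology are those of the underlying real Hilbert space, whose inner
  product is the real part of the complex one; the latter is linear in the second argument.\<close>

class complex_hilbert_space = real_inner + complete_space + complex_vector +
  fixes cinner :: "'a \<Rightarrow> 'a \<Rightarrow> complex"
  assumes scaleR_conv_scaleC: "r *\<^sub>R x = complex_of_real r *\<^sub>C x"
    and cinner_commute: "cinner x y = cnj (cinner y x)"
    and cinner_add_right: "cinner x (y + z) = cinner x y + cinner x z"
    and cinner_scaleC_right: "cinner x (c *\<^sub>C y) = c * cinner x y"
    and inner_conv_cinner: "inner x y = Re (cinner x y)"

typedef (overloaded) 'h bounded_op =
  "{T :: 'h :: complex_hilbert_space \<Rightarrow> 'h. bounded_linear T \<and> (\<forall>c x. T (c *\<^sub>C x) = c *\<^sub>C T x)}"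
  morphisms app Abs_bounded_op
  by (rule exI[of _ "\<lambda>x. x"]) auto

setup_lifting type_definition_bounded_op

lemma scaleC_zero_right: "c *\<^sub>C (0 :: 'a :: complex_vector) = 0"
  using scaleC_add_right[of c "0 :: 'a" 0] by simp

lemma scaleC_minus_right: "c *\<^sub>C (- (x :: 'a :: complex_vector)) = - (c *\<^sub>C x)"
  using scaleC_add_right[of c x "- x"] by (simp add: scaleC_zero_right eq_neg_iff_add_eq_0 add.commute)

lemma scaleC_diff_right: "c *\<^sub>C (x - (y :: 'a :: complex_vector)) = c *\<^sub>C x - c *\<^sub>C y"
  using scaleC_add_right[of c x "- y"] by (simp add: scaleC_minus_right)

lemma scaleC_scaleR_commute: "c *\<^sub>C (r *\<^sub>R (x :: 'a :: complex_hilbert_space)) = r *\<^sub>R (c *\<^sub>C x)"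
  by (simp add: scaleR_conv_scaleC scaleC_scaleC mult.commute)

lemma norm_scaleC: "norm (c *\<^sub>C (x :: 'a :: complex_hilbert_space)) = cmod c * norm x"
proof -
  have "cinner (c *\<^sub>C x) (c *\<^sub>C x) = c * cnj c * cinner x x"
    by (metis cinner_commute cinner_scaleC_right complex_cnj_mult mult.assoc)
  then have "inner (c *\<^sub>C x) (c *\<^sub>C x) = (cmod c)\<^sup>2 * inner x x"
    by (simp add: inner_conv_cinner complex_norm_square[symmetric])
  then show ?thesis
    by (simp add: norm_eq_sqrt_inner real_sqrt_mult)
qed

lemma bounded_linear_scaleC: "bounded_linear ((*\<^sub>C) c :: 'a :: complex_hilbert_space \<Rightarrow> 'a)"
  by (rule bounded_linear_intro[where K = "cmod c"])
    (auto simp: scaleC_add_right scaleC_scaleR_commute norm_scaleC mult.commute)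

instantiation bounded_op :: (complex_hilbert_space) complex_algebra
begin

lift_definition zero_bounded_op :: "'a bounded_op" is "\<lambda>_. 0"
  by (auto simp: scaleC_zero_right)

lift_definition one_bounded_op :: "'a bounded_op" is "\<lambda>x. x"
  by auto

lift_definition plus_bounded_op :: "'a bounded_op \<Rightarrow> 'a bounded_op \<Rightarrow> 'a bounded_op"
  is "\<lambda>S T x. S x + T x"
  by (auto simp: scaleC_add_right intro: bounded_linear_add)

lift_definition uminus_bounded_op :: "'a bounded_op \<Rightarrow> 'a bounded_op" is "\<lambda>T x. - T x"
  by (auto simp: scaleC_minus_right intro: bounded_linear_minus)

lift_definition minus_bounded_op :: "'a bounded_op \<Rightarrow> 'a bounded_op \<Rightarrow> 'a bounded_op"
  is "\<lambda>S T x. S x - T x"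
  by (auto simp: scaleC_diff_right intro: bounded_linear_sub)

lift_definition times_bounded_op :: "'a bounded_op \<Rightarrow> 'a bounded_op \<Rightarrow> 'a bounded_op"
  is "\<lambda>S T x. S (T x)"
  by (auto intro: bounded_linear_compose)

lift_definition scaleC_bounded_op :: "complex \<Rightarrow> 'a bounded_op \<Rightarrow> 'a bounded_op"
  is "\<lambda>c T x. c *\<^sub>C T x"
  by (auto simp: scaleC_scaleC mult.commute intro: bounded_linear_compose[OF bounded_linear_scaleC])

instance
  by standard
    (transfer; auto simp: fun_eq_iff scaleC_add_right scaleC_add_left scaleC_scaleC scaleC_one
      linear_simps)+

end

definition adj :: "'h :: complex_hilbert_space bounded_op \<Rightarrow> 'h bounded_op" where
  "adj T = (THE S. \<forall>x y. cinner (app S x) y = cinner x (app T y))"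

text \<open>Existence of adjoints, via the Riesz representation theorem.\<close>

lemma riesz_representation:
  fixes f :: "'a :: {real_inner, complete_space} \<Rightarrow> real"
  assumes "bounded_linear f"
  obtains z where "\<And>x. f x = inner z x"
proof (cases "\<forall>x. f x = 0")
  case True
  then show ?thesis using that[of 0] by simp
next
  case False
  interpret f: bounded_linear f by fact
  define C where "C = {x. f x = 1}"
  from False obtain u where "f u \<noteq> 0" by auto
  then have "u /\<^sub>R f u \<in> C" by (simp add: C_def f.scaleR)
  then have Cne: "C \<noteq> {}" by auto
  define d where "d = Inf ((\<lambda>x. (norm x)\<^sup>2) ` C)"
  have bdd: "bdd_below ((\<lambda>x. (norm x)\<^sup>2) ` C)" by (auto intro!: bdd_belowI[of _ 0])
  have d_le: "d \<le> (norm x)\<^sup>2" if "f x = 1" for x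
    unfolding d_def using that by (intro cInf_lower bdd) (auto simp: C_def)
  have "\<exists>x. f x = 1 \<and> (norm x)\<^sup>2 < d + 1 / real (Suc k)" for k
  proof -
    have "Inf ((\<lambda>x. (norm x)\<^sup>2) ` C) < d + 1 / real (Suc k)" by (simp add: d_def)
    from cInf_lessD[OF _ this] show ?thesis using Cne by (auto simp: C_def)
  qed
  then obtain x where fx: "\<And>k. f (x k) = 1" and xd: "\<And>k. (norm (x k))\<^sup>2 < d + 1 / real (Suc k)"
    by metis
  have par: "(norm (a - b))\<^sup>2 \<le> 2 * (norm a)\<^sup>2 + 2 * (norm b)\<^sup>2 - 4 * d" if "f a = 1" "f b = 1" for a b
  proof -
    have "f ((1/2) *\<^sub>R (a + b)) = 1" using that by (simp add: f.scaleR f.add)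
    from d_le[OF this] have "4 * d \<le> (norm (a + b))\<^sup>2"
      by (simp add: power_divide)
    moreover have "(norm (a - b))\<^sup>2 + (norm (a + b))\<^sup>2 = 2 * (norm a)\<^sup>2 + 2 * (norm b)\<^sup>2"
      by (simp add: power2_norm_eq_inner inner_simps inner_commute)
    ultimately show ?thesis by linarith
  qed
  have "Cauchy x"
  proof (rule metric_CauchyI)
    fix e :: real assume "e > 0"
    then obtain N where N: "4 / real (Suc N) < e\<^sup>2"
      using reals_Archimedean[of "e\<^sup>2 / 4"] by (auto simp: field_simps)
    have "dist (x m) (x k) < e" if "m \<ge> N" "k \<ge> N" for m k
    proof -
      have "(norm (x m - x k))\<^sup>2 \<le> 2 * (norm (x m))\<^sup>2 + 2 * (norm (x k))\<^sup>2 - 4 * d"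
        by (rule par) (rule fx)+
      also have "\<dots> \<le> 2 / real (Suc m) + 2 / real (Suc k)"
        using xd[of m] xd[of k] by simp
      also have "\<dots> \<le> 2 / real (Suc N) + 2 / real (Suc N)"
        using that by (intro add_mono divide_left_mono) auto
      also have "\<dots> < e\<^sup>2" using N by simp
      finally show ?thesis
        using \<open>e > 0\<close> by (simp add: dist_norm power2_less_imp_less)
    qed
    then show "\<exists>M. \<forall>m\<ge>M. \<forall>n\<ge>M. dist (x m) (x n) < e" by blast
  qed
  then obtain z where z: "x \<longlonglongrightarrow> z" using Cauchy_convergent convergent_def by blast
  have "(\<lambda>k. f (x k)) \<longlonglongrightarrow> f z" by (rule f.tendsto[OF z])
  then have fz: "f z = 1" using fx LIMSEQ_unique[OF _ tendsto_const] by fastforce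
  have "(norm z)\<^sup>2 \<le> d + 0"
  proof (rule LIMSEQ_le)
    show "(\<lambda>k. (norm (x k))\<^sup>2) \<longlonglongrightarrow> (norm z)\<^sup>2" by (intro tendsto_intros z)
    show "(\<lambda>k. d + 1 / real (Suc k)) \<longlonglongrightarrow> d + 0"
      by (intro tendsto_intros LIMSEQ_Suc[OF lim_1_over_n])
    show "\<exists>N. \<forall>n\<ge>N. (norm (x n))\<^sup>2 \<le> d + 1 / real (Suc n)" using xd less_imp_le by blast
  qed
  then have zmin: "(norm z)\<^sup>2 \<le> (norm w)\<^sup>2" if "f w = 1" for w using d_le[OF that] by linarith
  have orth: "inner z y = 0" if "f y = 0" for y
  proof (rule ccontr)
    assume ne: "inner z y \<noteq> 0"
    then have yy: "inner y y > 0" by auto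
    define t where "t = - inner z y / inner y y"
    have "f (z + t *\<^sub>R y) = 1" using fz that by (simp add: f.add f.scaleR)
    from zmin[OF this] have "0 \<le> 2 * t * inner z y + t\<^sup>2 * inner y y"
      unfolding power2_norm_eq_inner
      by (simp add: inner_simps inner_commute[of y z] power2_eq_square algebra_simps)
    also have "\<dots> = - ((inner z y)\<^sup>2 / inner y y)"
      using yy by (simp add: t_def power2_eq_square field_simps)
    also have "\<dots> < 0" using ne yy by simp
    finally show False by simp
  qed
  have "z \<noteq> 0" using fz f.zero by auto
  then have zz: "inner z z \<noteq> 0" by simp
  have "f w = inner (z /\<^sub>R inner z z) w" for w
  proof -
    have "f (w - f w *\<^sub>R z) = 0" by (simp add: f.diff f.scaleR fz)
    from orth[OF this] have "inner z w = f w * inner z z" by (simp add: inner_simps)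
    then show ?thesis using zz by simp
  qed
  then show ?thesis by (rule that)
qed

lemma cinner_eqI:
  assumes "\<And>y. inner x (y :: 'a :: complex_hilbert_space) = inner x' y"
  shows "x = x'"
  using assms by (metis inner_eq_zero_iff inner_diff_left right_minus_eq)

lemma Im_cinner: "Im (cinner x y) = - inner x (\<i> *\<^sub>C (y :: 'a :: complex_hilbert_space))"
  by (simp add: inner_conv_cinner cinner_scaleC_right)

lemma ex_adj: "\<exists>S. \<forall>x y. cinner (app S x) y = cinner x (app T y)"
proof -
  have T: "bounded_linear (app T)" and TC: "\<And>c x. app T (c *\<^sub>C x) = c *\<^sub>C app T x"
    using app[of T] by auto
  have "\<exists>z. \<forall>y. inner x (app T y) = inner z y" for x
    using riesz_representation[OF bounded_linear_compose[OF bounded_linear_inner_right T, of x]]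
    by metis
  then obtain S where S: "\<And>x y. inner x (app T y) = inner (S x) y" by metis
  have SC: "cinner (S x) y = cinner x (app T y)" for x y
    by (rule complex_eqI) (simp_all add: inner_conv_cinner[symmetric] Im_cinner S TC[symmetric])
  obtain K where K: "\<And>x. norm (app T x) \<le> norm x * K" "K > 0"
    using bounded_linear.pos_bounded[OF T] by metis
  have cl: "cinner (c *\<^sub>C x) y = cnj c * cinner x y" for c and x y :: 'a
    by (metis cinner_commute cinner_scaleC_right complex_cnj_mult)
  have "bounded_linear S"
  proof (rule bounded_linear_intro[where K = K])
    show "S (x + y) = S x + S y" for x y
      by (rule cinner_eqI) (simp add: S[symmetric] inner_add_left)
    show "S (r *\<^sub>R x) = r *\<^sub>R S x" for r x
      by (rule cinner_eqI) (simp add: S[symmetric])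
    show "norm (S x) \<le> norm x * K" for x
    proof (cases "S x = 0")
      case False
      have "(norm (S x))\<^sup>2 = inner x (app T (S x))" by (simp add: S power2_norm_eq_inner)
      also have "\<dots> \<le> norm x * norm (app T (S x))" by (rule norm_cauchy_schwarz)
      also have "\<dots> \<le> norm x * (norm (S x) * K)" by (intro mult_left_mono K norm_ge_zero)
      finally show ?thesis using False by (simp add: power2_eq_square mult.commute)
    qed (use K in simp)
  qed
  moreover have "S (c *\<^sub>C x) = c *\<^sub>C S x" for c x
    by (rule cinner_eqI) (simp add: inner_conv_cinner SC cl)
  ultimately have "app (Abs_bounded_op S) = S" by (simp add: Abs_bounded_op_inverse)
  then show ?thesis using SC by metis
qed

lemma cinner_adj: "cinner (app (adj T) x) y = cinner x (app T y)"
proof -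
  obtain S where S: "\<forall>x y. cinner (app S x) y = cinner x (app T y)" using ex_adj by blast
  have "R = S" if "\<forall>x y. cinner (app R x) y = cinner x (app T y)" for R
  proof -
    have "app R x = app S x" for x
      by (rule cinner_eqI) (simp add: inner_conv_cinner S that)
    then show ?thesis by (simp add: app_inject[symmetric] fun_eq_iff)
  qed
  then have "\<forall>x y. cinner (app (adj T) x) y = cinner x (app T y)"
    unfolding adj_def using S by (rule theI[rotated])
  then show ?thesis by blast
qed


section \<open>\<open>W\<^sup>*\<close>-probability spaces\<close>

definition weak_operator_topology :: "'h :: complex_hilbert_space bounded_op topology" where
  "weak_operator_topology =
     pullback_topology UNIV (\<lambda>T (x, y). cinner x (app T y)) (euclidean :: ('h \<times> 'h \<Rightarrow> complex) topology)"

locale von_neumann_algebra =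
  fixes A :: "'h :: complex_hilbert_space bounded_op set"
  assumes one_mem: "1 \<in> A"
    and add_mem: "\<lbrakk>a \<in> A; b \<in> A\<rbrakk> \<Longrightarrow> a + b \<in> A"
    and scaleC_mem: "a \<in> A \<Longrightarrow> c *\<^sub>C a \<in> A"
    and mult_mem: "\<lbrakk>a \<in> A; b \<in> A\<rbrakk> \<Longrightarrow> a * b \<in> A"
    and adj_mem: "a \<in> A \<Longrightarrow> adj a \<in> A"
    and closedin_weak: "closedin weak_operator_topology A"

locale finite_von_neumann_algebra = von_neumann_algebra A
  for A :: "'h :: complex_hilbert_space bounded_op set" +
  assumes isometry_imp_unitary: "\<lbrakk>u \<in> A; adj u * u = 1\<rbrakk> \<Longrightarrow> u * adj u = 1"

definition positive_op :: "'h :: complex_hilbert_space bounded_op \<Rightarrow> bool" where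
  "positive_op T \<longleftrightarrow> (\<forall>x. cinner x (app T x) \<in> \<real> \<and> 0 \<le> Re (cinner x (app T x)))"

definition op_le :: "'h :: complex_hilbert_space bounded_op \<Rightarrow> 'h bounded_op \<Rightarrow> bool" where
  "op_le S T \<longleftrightarrow> positive_op (T - S)"

definition directed_op :: "'h :: complex_hilbert_space bounded_op set \<Rightarrow> bool" where
  "directed_op D \<longleftrightarrow> D \<noteq> {} \<and> (\<forall>a\<in>D. \<forall>b\<in>D. \<exists>c\<in>D. op_le a c \<and> op_le b c)"

text \<open>Least upper bound among the self-adjoint elements of \<open>A\<close>.\<close>

definition is_lub_op ::
  "'h :: complex_hilbert_space bounded_op set \<Rightarrow> 'h bounded_op set \<Rightarrow> 'h bounded_op \<Rightarrow> bool" where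
  "is_lub_op A D s \<longleftrightarrow> s \<in> A \<and> adj s = s \<and> (\<forall>d\<in>D. op_le d s) \<and>
     (\<forall>t\<in>A. adj t = t \<and> (\<forall>d\<in>D. op_le d t) \<longrightarrow> op_le s t)"

text \<open>Functionals on \<open>A\<close> are represented by functions on all bounded operators, of which only
  the values on \<open>A\<close> matter.\<close>

locale W_star_probability_space = finite_von_neumann_algebra A
  for A :: "'h :: complex_hilbert_space bounded_op set" +
  fixes \<phi> :: "'h bounded_op \<Rightarrow> complex"
  assumes state_add: "\<lbrakk>a \<in> A; b \<in> A\<rbrakk> \<Longrightarrow> \<phi> (a + b) = \<phi> a + \<phi> b"
    and state_scaleC: "a \<in> A \<Longrightarrow> \<phi> (c *\<^sub>C a) = c * \<phi> a"
    and state_one: "\<phi> 1 = 1"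
    and state_pos: "a \<in> A \<Longrightarrow> \<phi> (adj a * a) \<in> \<real> \<and> 0 \<le> Re (\<phi> (adj a * a))"
    and state_normal: "\<lbrakk>D \<subseteq> A; \<forall>d\<in>D. positive_op d; directed_op D; is_lub_op A D s\<rbrakk>
        \<Longrightarrow> Re (\<phi> s) = (SUP d\<in>D. Re (\<phi> d))"
    and state_faithful: "\<lbrakk>a \<in> A; \<phi> (adj a * a) = 0\<rbrakk> \<Longrightarrow> a = 0"
    and state_trace: "\<lbrakk>a \<in> A; b \<in> A\<rbrakk> \<Longrightarrow> \<phi> (a * b) = \<phi> (b * a)"

definition trace_norm2 ::
  "('h :: complex_hilbert_space bounded_op \<Rightarrow> complex) \<Rightarrow> 'h bounded_op \<Rightarrow> real" where
  "trace_norm2 \<phi> a = sqrt (Re (\<phi> (adj a * a)))"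


section \<open>Free cumulants and free independence\<close>

definition noncrossing_partition :: "nat \<Rightarrow> nat set set \<Rightarrow> bool" where
  "noncrossing_partition n \<pi> \<longleftrightarrow> partition_on {..<n} \<pi> \<and>
     \<not> (\<exists>V\<in>\<pi>. \<exists>W\<in>\<pi>. V \<noteq> W \<and> (\<exists>a b c d. a < b \<and> b < c \<and> c < d \<and> a \<in> V \<and> c \<in> V \<and> b \<in> W \<and> d \<in> W))"

text \<open>The moment-cumulant formula
  \<open>\<phi>(a\<^sub>1\<cdots>a\<^sub>n) = \<Sum>\<^bsub>\<pi> \<in> NC(n)\<^esub> \<Prod>\<^bsub>V \<in> \<pi>\<^esub> \<kappa>\<^bsub>|V|\<^esub>(a|V)\<close>, solved for the one-block term.
  Only nonempty lists are meaningful.\<close>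

function free_cumulant :: "('a :: monoid_mult \<Rightarrow> complex) \<Rightarrow> 'a list \<Rightarrow> complex" where
  "free_cumulant \<phi> as = \<phi> (prod_list as) -
     (\<Sum>\<pi> | noncrossing_partition (length as) \<pi> \<and> \<pi> \<noteq> {{..<length as}}.
        \<Prod>V\<in>\<pi>. free_cumulant \<phi> (nths as V))"
  by auto

termination
proof (relation "Wellfounded.measure (\<lambda>(_, as). length as)")
  show "wf (Wellfounded.measure (\<lambda>(_ :: 'a \<Rightarrow> complex, as :: 'a list). length as))" by simp
next
  fix \<phi> :: "'a \<Rightarrow> complex" and as :: "'a list" and \<pi> V
  assume \<pi>: "\<pi> \<in> {\<pi>. noncrossing_partition (length as) \<pi> \<and> \<pi> \<noteq> {{..<length as}}}" and V: "V \<in> \<pi>"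
  from \<pi> have part: "partition_on {..<length as} \<pi>" and ne: "\<pi> \<noteq> {{..<length as}}"
    by (auto simp: noncrossing_partition_def)
  have sub: "V \<subseteq> {..<length as}"
    using part V by (auto simp: partition_on_def)
  moreover have "V \<noteq> {..<length as}"
  proof
    assume eq: "V = {..<length as}"
    have "W = V" if W: "W \<in> \<pi>" for W
    proof (rule ccontr)
      assume "W \<noteq> V"
      then have "W \<inter> V = {}"
        using part V W by (auto simp: partition_on_def disjoint_def)
      moreover have "W \<subseteq> V" "W \<noteq> {}"
        using part W eq by (auto simp: partition_on_def)
      ultimately show False by blast
    qed
    then show False using ne V eq by blast
  qed
  ultimately have "card V < length as"
    using psubset_card_mono[of "{..<length as}" V] by auto
  moreover have "{i. i < length as \<and> i \<in> V} = V" using sub by auto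
  ultimately show "((\<phi>, nths as V), (\<phi>, as)) \<in> Wellfounded.measure (\<lambda>(_, as). length as)"
    by (simp add: length_nths)
qed

declare free_cumulant.simps [simp del]

definition kappa :: "('a :: monoid_mult \<Rightarrow> complex) \<Rightarrow> nat \<Rightarrow> 'a \<Rightarrow> complex" where
  "kappa \<phi> n a = free_cumulant \<phi> (replicate n a)"

inductive_set generated_algebra :: "'a :: complex_algebra set \<Rightarrow> 'a set" for S where
  base: "a \<in> S \<Longrightarrow> a \<in> generated_algebra S"
| one: "1 \<in> generated_algebra S"
| add: "\<lbrakk>a \<in> generated_algebra S; b \<in> generated_algebra S\<rbrakk> \<Longrightarrow> a + b \<in> generated_algebra S"
| scaleC: "a \<in> generated_algebra S \<Longrightarrow> c *\<^sub>C a \<in> generated_algebra S"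
| mult: "\<lbrakk>a \<in> generated_algebra S; b \<in> generated_algebra S\<rbrakk> \<Longrightarrow> a * b \<in> generated_algebra S"

definition free_subalgebras ::
  "('a :: complex_algebra \<Rightarrow> complex) \<Rightarrow> 'i set \<Rightarrow> ('i \<Rightarrow> 'a set) \<Rightarrow> bool" where
  "free_subalgebras \<phi> I B \<longleftrightarrow>
     (\<forall>is as. is \<noteq> [] \<and> set is \<subseteq> I \<and> distinct_adj is \<and>
        list_all2 (\<lambda>i a. a \<in> B i \<and> \<phi> a = 0) is as \<longrightarrow> \<phi> (prod_list as) = 0)"

definition freely_independent ::
  "('a :: complex_algebra \<Rightarrow> complex) \<Rightarrow> 'i set \<Rightarrow> ('i \<Rightarrow> 'a) \<Rightarrow> bool" where
  "freely_independent \<phi> I a \<longleftrightarrow> free_subalgebras \<phi> I (\<lambda>i. generated_algebra {a i})"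


section \<open>Free Poisson random measures\<close>

definition finite_borel_sets :: "real set set" where
  "finite_borel_sets = {E \<in> sets borel. emeasure lborel E < \<infinity>}"

locale free_Poisson_random_measure = W_star_probability_space A \<phi>
  for A :: "'h :: complex_hilbert_space bounded_op set" and \<phi> :: "'h bounded_op \<Rightarrow> complex" +
  fixes X :: "real set \<Rightarrow> 'h bounded_op"
  assumes X_mem: "E \<in> finite_borel_sets \<Longrightarrow> X E \<in> A"
    and X_selfadjoint: "E \<in> finite_borel_sets \<Longrightarrow> adj (X E) = X E"
    and X_cumulants: "\<lbrakk>E \<in> finite_borel_sets; 1 \<le> n\<rbrakk>
        \<Longrightarrow> kappa \<phi> n (X E) = complex_of_real (measure lborel E)"
    and X_free: "\<And>(k :: nat) E. \<lbrakk>1 \<le> k; \<forall>i\<in>{1..k}. E i \<in> finite_borel_sets; disjoint_family_on E {1..k}\<rbrakk>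
        \<Longrightarrow> freely_independent \<phi> {1..k} (\<lambda>i. X (E i))"
    and X_additive: "\<And>(k :: nat) E. \<lbrakk>1 \<le> k; \<forall>i\<in>{1..k}. E i \<in> finite_borel_sets; disjoint_family_on E {1..k}\<rbrakk>
        \<Longrightarrow> X (\<Union>i\<in>{1..k}. E i) = (\<Sum>i\<in>{1..k}. X (E i))"

definition centered_free_Poisson_random_measure ::
  "'h :: complex_hilbert_space bounded_op set \<Rightarrow> ('h bounded_op \<Rightarrow> complex) \<Rightarrow>
   (real set \<Rightarrow> 'h bounded_op) \<Rightarrow> bool" where
  "centered_free_Poisson_random_measure A \<phi> Y \<longleftrightarrow>
     (\<exists>X. free_Poisson_random_measure A \<phi> X \<and>
        (\<forall>E\<in>finite_borel_sets. Y E = X E - complex_of_real (measure lborel E) *\<^sub>C 1))"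

definition simple_fun :: "nat \<Rightarrow> (nat \<Rightarrow> complex) \<Rightarrow> (nat \<Rightarrow> real set) \<Rightarrow> real \<Rightarrow> complex" where
  "simple_fun n c E x = (\<Sum>i=1..n. c i * indicator (E i) x)"

text \<open>The integral of the simple function \<open>simple_fun n c E\<close> against \<open>Y\<close>, in terms of the
  given representation.\<close>

definition simple_integral_op ::
  "(real set \<Rightarrow> 'h :: complex_hilbert_space bounded_op) \<Rightarrow> nat \<Rightarrow> (nat \<Rightarrow> complex) \<Rightarrow>
   (nat \<Rightarrow> real set) \<Rightarrow> 'h bounded_op" where
  "simple_integral_op Y n c E = (\<Sum>i=1..n. c i *\<^sub>C Y (E i))"

definition L2_norm :: "(real \<Rightarrow> complex) \<Rightarrow> real" where
  "L2_norm f = sqrt (LINT x|lborel. (cmod (f x))\<^sup>2)"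

end

theory Submission
  imports Defs
begin

text \<open>The centered elements \<open>Y E\<close> of disjoint sets form an orthogonal family for the inner product
  \<open>\<phi> (a\<^sup>* b)\<close>, and \<open>Y E\<close> has squared length \<open>|E|\<close>; the theorem is Pythagoras' identity for this
  family.  Both facts concern second moments only.  For one set, the cumulants of order one and two
  are mean and variance, so that \<open>\<kappa>\<^sub>1 = \<kappa>\<^sub>2 = |E|\<close> makes \<open>Y E\<close> centered with variance \<open>|E|\<close>
  (lemma \<open>state_centered_square\<close>).  For two disjoint sets, the product \<open>Y E * Y F\<close> is an alternating
  product of centered elements of free algebras, hence has expectation zero
  (lemma \<open>state_centered_mult\<close>).  On the function side, at most one indicator is nonzero at each
  point, so the cross terms of \<open>|s|\<^sup>2\<close> vanish there too.\<close>

section \<open>Algebra of bounded operators\<close>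

lemma scaleC_zero_left: "0 *\<^sub>C (x :: 'a :: complex_vector) = 0"
  using scaleC_add_left[of 0 0 x] by simp

lemma scaleC_minus_left: "(- c) *\<^sub>C (x :: 'a :: complex_vector) = - (c *\<^sub>C x)"
  using scaleC_add_left[of c "- c" x]
  by (simp add: scaleC_zero_left eq_neg_iff_add_eq_0 add.commute)

lemma cinner_scaleC_left:
  "cinner (c *\<^sub>C x) (y :: 'a :: complex_hilbert_space) = cnj c * cinner x y"
  by (metis cinner_commute cinner_scaleC_right complex_cnj_mult)

lemma cinner_add_left:
  "cinner (x + y) (z :: 'a :: complex_hilbert_space) = cinner x z + cinner y z"
  by (metis cinner_commute cinner_add_right complex_cnj_add)

lemma adj_eqI:
  assumes "\<And>x y. cinner (app S x) y = cinner x (app T y)"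
  shows "adj T = S"
proof -
  have "app (adj T) x = app S x" for x
    by (rule cinner_eqI) (simp add: inner_conv_cinner assms cinner_adj)
  then show ?thesis by (simp add: app_inject[symmetric] fun_eq_iff)
qed

lemma adj_zero: "adj 0 = (0 :: 'h :: complex_hilbert_space bounded_op)"
proof (rule adj_eqI)
  fix x y :: 'h
  show "cinner (app 0 x) y = cinner x (app 0 y)"
    using cinner_scaleC_left[of 0 0 y] cinner_scaleC_right[of x 0 0]
    by (simp add: zero_bounded_op.rep_eq scaleC_zero_left)
qed

lemma adj_one: "adj 1 = (1 :: 'h :: complex_hilbert_space bounded_op)"
  by (rule adj_eqI) (simp add: one_bounded_op.rep_eq)

lemma adj_add: "adj (S + T) = adj S + adj T"
  by (rule adj_eqI)
    (simp add: plus_bounded_op.rep_eq cinner_add_left cinner_add_right cinner_adj)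

lemma adj_scaleC: "adj (c *\<^sub>C T) = cnj c *\<^sub>C adj T"
  by (rule adj_eqI)
    (simp add: scaleC_bounded_op.rep_eq cinner_scaleC_left cinner_scaleC_right cinner_adj)

lemma adj_sum: "adj (\<Sum>i\<in>I. T i) = (\<Sum>i\<in>I. adj (T i))"
  by (induction I rule: infinite_finite_induct) (simp_all add: adj_zero adj_add)

context W_star_probability_space
begin

lemma zero_mem: "0 \<in> A"
  using scaleC_mem[OF one_mem, of 0] by (simp add: scaleC_zero_left)

lemma state_zero: "\<phi> 0 = 0"
  using state_scaleC[OF one_mem, of 0] by (simp add: scaleC_zero_left)

lemma sum_mem: "(\<And>i. i \<in> I \<Longrightarrow> a i \<in> A) \<Longrightarrow> (\<Sum>i\<in>I. a i) \<in> A"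
  by (induction I rule: infinite_finite_induct) (auto simp: zero_mem intro: add_mem)

lemma state_sum: "(\<And>i. i \<in> I \<Longrightarrow> a i \<in> A) \<Longrightarrow> \<phi> (\<Sum>i\<in>I. a i) = (\<Sum>i\<in>I. \<phi> (a i))"
  by (induction I rule: infinite_finite_induct)
    (auto simp: state_zero state_add sum_mem)

lemma power2_trace_norm2: "a \<in> A \<Longrightarrow> (trace_norm2 \<phi> a)\<^sup>2 = Re (\<phi> (adj a * a))"
  using state_pos[of a] by (simp add: trace_norm2_def)

text \<open>Pythagoras' identity: the cross terms of \<open>\<phi> (s\<^sup>* s)\<close> vanish by orthogonality.\<close>

lemma trace_norm2_sum_orthogonal:
  assumes fin: "finite I"
    and mem: "\<And>i. i \<in> I \<Longrightarrow> a i \<in> A"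
    and orth: "\<And>i j. \<lbrakk>i \<in> I; j \<in> I; i \<noteq> j\<rbrakk> \<Longrightarrow> \<phi> (adj (a i) * a j) = 0"
  shows "(trace_norm2 \<phi> (\<Sum>i\<in>I. c i *\<^sub>C a i))\<^sup>2 = (\<Sum>i\<in>I. (cmod (c i))\<^sup>2 * (trace_norm2 \<phi> (a i))\<^sup>2)"
proof -
  let ?s = "\<Sum>i\<in>I. c i *\<^sub>C a i"
  have pair: "(cnj (c i) *\<^sub>C adj (a i)) * (c j *\<^sub>C a j) = (cnj (c i) * c j) *\<^sub>C (adj (a i) * a j)"
    for i j
    by (simp add: mult_scaleC_left mult_scaleC_right scaleC_scaleC mult.commute)
  have prod_mem: "adj (a i) * a j \<in> A" if "i \<in> I" "j \<in> I" for i j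
    using that by (intro mult_mem adj_mem mem)
  have "adj ?s * ?s = (\<Sum>i\<in>I. \<Sum>j\<in>I. (cnj (c i) * c j) *\<^sub>C (adj (a i) * a j))"
    by (simp add: adj_sum adj_scaleC sum_product pair)
  then have "\<phi> (adj ?s * ?s) = (\<Sum>i\<in>I. \<Sum>j\<in>I. cnj (c i) * c j * \<phi> (adj (a i) * a j))"
    by (simp add: state_sum state_scaleC sum_mem scaleC_mem prod_mem)
  also have "\<dots> = (\<Sum>i\<in>I. \<Sum>j\<in>I. if j = i then c i * cnj (c i) * \<phi> (adj (a i) * a i) else 0)"
    by (intro sum.cong refl) (auto simp: orth mult.commute)
  also have "\<dots> = (\<Sum>i\<in>I. complex_of_real ((cmod (c i))\<^sup>2) * \<phi> (adj (a i) * a i))"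
    using fin by (simp del: of_real_power add: complex_norm_square)
  finally have "Re (\<phi> (adj ?s * ?s)) = (\<Sum>i\<in>I. (cmod (c i))\<^sup>2 * Re (\<phi> (adj (a i) * a i)))"
    by simp
  then show ?thesis
    by (simp add: power2_trace_norm2 sum_mem scaleC_mem mem)
qed

end

section \<open>The first two free cumulants\<close>

lemma partition_on_singleton:
  assumes "partition_on {x} P"
  shows "P = {{x}}"
proof -
  have "V = {x}" if "V \<in> P" for V
  proof -
    have "V \<subseteq> {x}" "V \<noteq> {}" using assms that by (auto simp: partition_on_def)
    then show ?thesis by blast
  qed
  moreover have "P \<noteq> {}" using assms by (auto simp: partition_on_def)
  ultimately show ?thesis by blast
qed

lemma partition_on_doubleton:
  assumes "partition_on {x, y} P" "P \<noteq> {{x, y}}"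
  shows "P = {{x}, {y}}"
proof -
  have sub: "V = {x} \<or> V = {y} \<or> V = {x, y}" if "V \<in> P" for V
  proof -
    have "V \<subseteq> {x, y}" "V \<noteq> {}" using assms(1) that by (auto simp: partition_on_def)
    then show ?thesis by blast
  qed
  have disj: "V = W \<or> V \<inter> W = {}" if "V \<in> P" "W \<in> P" for V W
    using assms(1) that by (auto simp: partition_on_def disjoint_def)
  have no_top: "{x, y} \<notin> P"
  proof
    assume top: "{x, y} \<in> P"
    have "V = {x, y}" if "V \<in> P" for V
      using disj[OF that top] sub[OF that] by blast
    with top have "P = {{x, y}}" by blast
    with assms(2) show False by contradiction
  qed
  have cover: "\<exists>V\<in>P. z \<in> V" if "z \<in> {x, y}" for z
  proof -
    have "z \<in> \<Union> P" using partition_onD1[OF assms(1)] that by simp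
    then show ?thesis by blast
  qed
  have single: "V = {z}" if "V \<in> P" "z \<in> V" for V z
    using sub[OF that(1)] no_top that by blast
  have "{x} \<in> P" "{y} \<in> P"
    using cover[of x] cover[of y] single by fastforce+
  moreover have "P \<subseteq> {{x}, {y}}" using sub no_top by blast
  ultimately show ?thesis by blast
qed

lemma free_cumulant_single: "free_cumulant \<phi> [a] = \<phi> a"
proof -
  have "{\<pi>. noncrossing_partition (length [a]) \<pi> \<and> \<pi> \<noteq> {{..<length [a]}}} = {}"
    by (auto simp: noncrossing_partition_def lessThan_Suc dest: partition_on_singleton)
  then show ?thesis by (subst free_cumulant.simps) (simp only: sum.empty, simp)
qed

text \<open>The second free cumulant is the covariance: two points admit no crossing, and the only
  partition to subtract from the moment is the one into singletons.\<close>

lemma free_cumulant_pair: "free_cumulant \<phi> [a, b] = \<phi> (a * b) - \<phi> a * \<phi> b"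
proof -
  have two: "{..<length [a, b]} = {1, 0}" by (auto simp: lessThan_Suc)
  have "noncrossing_partition (length [a, b]) {{1}, {0}}"
    unfolding noncrossing_partition_def two by (auto simp: partition_on_def disjoint_def)
  moreover have "{{1 :: nat}, {0}} \<noteq> {{1, 0}}" by simp
  moreover have "\<pi> = {{1}, {0}}"
    if "noncrossing_partition (length [a, b]) \<pi>" "\<pi> \<noteq> {{1, 0}}" for \<pi>
    using that by (intro partition_on_doubleton) (auto simp: noncrossing_partition_def two[simplified])
  ultimately have "{\<pi>. noncrossing_partition (length [a, b]) \<pi> \<and> \<pi> \<noteq> {{..<length [a, b]}}} = {{{1}, {0}}}"
    unfolding two by blast
  moreover have "{Suc 0} \<noteq> {0}" by simp
  ultimately show ?thesis
    by (subst free_cumulant.simps)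
      (simp only:, simp add: nths_Cons free_cumulant_single mult.commute)
qed

section \<open>Second moments of the centered measure\<close>

context free_Poisson_random_measure
begin

definition centered :: "real set \<Rightarrow> 'h bounded_op" where
  "centered E = X E - complex_of_real (measure lborel E) *\<^sub>C 1"

lemma centered_conv_add: "centered E = X E + complex_of_real (- measure lborel E) *\<^sub>C 1"
  by (simp add: centered_def scaleC_minus_left)

lemma centered_mem: "E \<in> finite_borel_sets \<Longrightarrow> centered E \<in> A"
  unfolding centered_conv_add by (intro add_mem scaleC_mem one_mem X_mem)

lemma adj_centered: "E \<in> finite_borel_sets \<Longrightarrow> adj (centered E) = centered E"
  by (simp only: centered_conv_add adj_add adj_scaleC adj_one X_selfadjoint complex_cnj_complex_of_real)

lemma state_X: "E \<in> finite_borel_sets \<Longrightarrow> \<phi> (X E) = complex_of_real (measure lborel E)"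
  using X_cumulants[of E 1] by (simp add: kappa_def free_cumulant_single)

lemma state_X_square:
  assumes "E \<in> finite_borel_sets"
  shows "\<phi> (X E * X E) = complex_of_real (measure lborel E + (measure lborel E)\<^sup>2)"
  using X_cumulants[OF assms, of 2] state_X[OF assms]
  by (simp add: kappa_def numeral_2_eq_2 free_cumulant_pair algebra_simps)

lemma state_centered: "E \<in> finite_borel_sets \<Longrightarrow> \<phi> (centered E) = 0"
  unfolding centered_conv_add
  by (simp only: state_add state_scaleC scaleC_mem one_mem X_mem state_one state_X) simp

lemma state_centered_square:
  assumes E: "E \<in> finite_borel_sets"
  shows "\<phi> (centered E * centered E) = complex_of_real (measure lborel E)"
proof -
  let ?m = "complex_of_real (- measure lborel E)"
  have "centered E * centered E = X E * X E + ((2 * ?m) *\<^sub>C X E + ?m\<^sup>2 *\<^sub>C 1)"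
    unfolding centered_conv_add
    by (simp only: distrib_left distrib_right mult_scaleC_left mult_scaleC_right scaleC_scaleC
        mult_1_left mult_1_right mult_2 scaleC_add_left scaleC_add_right power2_eq_square add.assoc)
  then have "\<phi> (centered E * centered E) = \<phi> (X E * X E) + (2 * ?m * \<phi> (X E) + ?m\<^sup>2)"
    using E by (simp only: state_add state_scaleC add_mem mult_mem scaleC_mem one_mem X_mem state_one mult_1_right)
  then show ?thesis
    by (simp add: state_X[OF E] state_X_square[OF E] power2_eq_square)
qed

text \<open>Freeness yields the vanishing directly: \<open>centered (E i)\<close> lies in the unital algebra generated
  by \<open>X (E i)\<close>, so the product is an alternating word of length two in centered elements.\<close>

lemma state_centered_mult:
  assumes E: "\<forall>i\<in>{1..n::nat}. E i \<in> finite_borel_sets" and disj: "disjoint_family_on E {1..n}"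
    and ij: "i \<in> {1..n}" "j \<in> {1..n}" "i \<noteq> j"
  shows "\<phi> (centered (E i) * centered (E j)) = 0"
proof -
  have "1 \<le> n" using ij by auto
  then have free: "free_subalgebras \<phi> {1..n} (\<lambda>i. generated_algebra {X (E i)})"
    using X_free[OF _ E disj] by (simp add: freely_independent_def)
  have gen: "centered F \<in> generated_algebra {X F}" for F
    unfolding centered_conv_add
    by (intro generated_algebra.intros) simp
  have "\<phi> (prod_list [centered (E i), centered (E j)]) = 0"
    using free[unfolded free_subalgebras_def, rule_format, of "[i, j]" "[centered (E i), centered (E j)]"]
      E ij by (simp add: gen state_centered)
  then show ?thesis by simp
qed

lemma power2_trace_norm2_centered:
  "E \<in> finite_borel_sets \<Longrightarrow> (trace_norm2 \<phi> (centered E))\<^sup>2 = measure lborel E"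
  by (simp add: power2_trace_norm2 centered_mem adj_centered state_centered_square)

end

section \<open>The square norm of a simple function\<close>

text \<open>The square passes inside the sum because at most one summand is nonzero at each point.\<close>

lemma cmod_simple_fun_square:
  assumes disj: "disjoint_family_on E {1..n}"
  shows "(cmod (simple_fun n c E x))\<^sup>2 = (\<Sum>i=1..n. (cmod (c i))\<^sup>2 * indicator (E i) x)"
proof (cases "\<exists>i\<in>{1..n}. x \<in> E i")
  case True
  then obtain i where i: "i \<in> {1..n}" "x \<in> E i" by blast
  have ind: "indicator (E j) x = (if j = i then 1 else 0 :: 'b :: zero_neq_one)"
    if "j \<in> {1..n}" for j
    using disjoint_family_onD[OF disj i(1) that] i by (auto simp: indicator_def)
  have "simple_fun n c E x = (\<Sum>j=1..n. c j * (if j = i then 1 else 0))"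
    unfolding simple_fun_def by (intro sum.cong refl) (simp add: ind)
  then have lhs: "simple_fun n c E x = c i" using i(1) by (simp add: if_distrib cong: if_cong)
  have "(\<Sum>j=1..n. (cmod (c j))\<^sup>2 * indicator (E j) x) = (\<Sum>j=1..n. (cmod (c j))\<^sup>2 * (if j = i then 1 else 0))"
    by (intro sum.cong refl) (simp add: ind)
  also have "\<dots> = (cmod (c i))\<^sup>2" using i(1) by (simp add: if_distrib cong: if_cong)
  finally show ?thesis by (simp add: lhs)
next
  case False
  then show ?thesis by (simp add: simple_fun_def)
qed

lemma L2_norm_simple_fun_square:
  assumes E: "\<forall>i\<in>{1..n}. E i \<in> finite_borel_sets" and disj: "disjoint_family_on E {1..n}"
  shows "(L2_norm (simple_fun n c E))\<^sup>2 = (\<Sum>i=1..n. (cmod (c i))\<^sup>2 * measure lborel (E i))"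
proof -
  have "integrable lborel (\<lambda>x. (cmod (c i))\<^sup>2 * indicator (E i) x)" if "i \<in> {1..n}" for i
    using E that by (auto simp: finite_borel_sets_def)
  then have "(LINT x|lborel. (cmod (simple_fun n c E x))\<^sup>2)
      = (\<Sum>i=1..n. (cmod (c i))\<^sup>2 * measure lborel (E i))"
    unfolding cmod_simple_fun_square[OF disj] by (subst Bochner_Integration.integral_sum) simp_all
  moreover have "0 \<le> (LINT x|lborel. (cmod (simple_fun n c E x))\<^sup>2)" by simp
  ultimately show ?thesis by (simp add: L2_norm_def)
qed

section \<open>The isometry\<close>

theorem lemma6p3:
  fixes A :: "'h :: complex_hilbert_space bounded_op set"
    and \<phi> :: "'h bounded_op \<Rightarrow> complex"
    and Y :: "real set \<Rightarrow> 'h bounded_op"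
    and n :: nat
    and c :: "nat \<Rightarrow> complex"
    and E :: "nat \<Rightarrow> real set"
  assumes "W_star_probability_space A \<phi>"
    and "centered_free_Poisson_random_measure A \<phi> Y"
    and "\<forall>i\<in>{1..n}. E i \<in> finite_borel_sets"
    and "disjoint_family_on E {1..n}"
  shows "(trace_norm2 \<phi> (simple_integral_op Y n c E))\<^sup>2 = (L2_norm (simple_fun n c E))\<^sup>2"
proof -
  from assms(2) obtain X where X: "free_Poisson_random_measure A \<phi> X"
    and Y: "\<forall>E\<in>finite_borel_sets. Y E = X E - complex_of_real (measure lborel E) *\<^sub>C 1"
    unfolding centered_free_Poisson_random_measure_def by blast
  interpret free_Poisson_random_measure A \<phi> X by (rule X)
  have "simple_integral_op Y n c E = (\<Sum>i=1..n. c i *\<^sub>C centered (E i))"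
    using Y assms(3) by (simp add: simple_integral_op_def centered_def)
  moreover have "(trace_norm2 \<phi> (\<Sum>i=1..n. c i *\<^sub>C centered (E i)))\<^sup>2
      = (\<Sum>i=1..n. (cmod (c i))\<^sup>2 * (trace_norm2 \<phi> (centered (E i)))\<^sup>2)"
    using assms(3) state_centered_mult[OF assms(3,4)]
    by (intro trace_norm2_sum_orthogonal) (simp_all add: centered_mem adj_centered)
  ultimately show ?thesis
    using assms(3) L2_norm_simple_fun_square[OF assms(3,4)]
    by (simp add: power2_trace_norm2_centered)
qed

end
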